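(* Let $r\ge 1$, let $m,n\ge 0$ be integers with $m+n>0$, and let $\mu=(\mu_1,\mu_2,\ldots)$ be a partition of $r$. Let $\chi_{\Phi_{m,n}^{q,r}}$ be the character of the sign $q$-permutation representation of the Iwahori--Hecke algebra $H_r(q)$ on $V^{\otimes r}$, where $\dim V_{\bar 0}=m$ and $\dim V_{\bar 1}=n$, and write $\chi_{\Phi_{m,n}^{q,r}}(\mu)$ for its value on the standard element $T_{\gamma_\mu}$. Then $$\chi_{\Phi_{m,n}^{q,r}}(\mu)=\prod_{i=1}^{\ell(\mu)}\ \sum_{(\alpha;\beta)\models \mu_i}\binom{m}{\ell(\alpha)}\binom{n}{\ell(\beta)}(-q)^{|\beta|-\ell(\beta)}(1-q)^{\ell(\alpha;\beta)-1}.$$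
   Context: Let $q$ be an indeterminate. The Iwahori--Hecke algebra $H_r(q)$ is the associative unital algebra over $\mathbb{C}(q)$ generated by $T_1,\ldots,T_{r-1}$ with relations $T_i^2=(1-q)T_i+q$, $T_iT_j=T_jT_i$ for $|i-j|\ge 2$, and $T_iT_{i+1}T_i=T_{i+1}T_iT_{i+1}$. For a partition $\mu$, $\ell(\mu)$ is its number of nonzero parts. For $\mu\vdash r$, the standard element is $T_{\gamma_\mu}=\prod_{i=1}^{\ell(\mu)}T_{a_{i-1}+1}T_{a_{i-1}+2}\cdots T_{a_i-1}$ (product taken in increasing order of $i$), with $a_0=0$, $a_i=a_{i-1}+\mu_i$; a factor with $\mu_i=1$ is $1$. In the sum, $(\alpha;\beta)\models k$ means that $(\alpha;\beta)$ is a bicomposition of $k$: a pair of finite, possibly empty, sequences $\alpha,\beta$ of positive integers with $|\alpha|+|\beta|=k$, where $|\cdot|$ denotes the sum of the entries; $\ell(\alpha),\ell(\beta)$ are the numbers of parts and $\ell(\alpha;\beta)=\ell(\alpha)+\ell(\beta)$. Sign $q$-permutation representation: fix a square root $\sqrt q$ and extend scalars to $\mathbb{C}(\sqrt q)$. Let $V=V_{\bar 0}\oplus V_{\bar 1}$ be the $\mathbb{Z}_2$-graded vector space with basis $v_1,\ldots,v_m$ of $V_{\bar 0}$ and $v_{m+1},\ldots,v_{m+n}$ of $V_{\bar 1}$; $|v_i|=0$ for $i\le m$ and $|v_i|=1$ for $i>m$. Define an operator $R$ on $V\otimes V$, written on the right, by $$(v_i\otimes v_j)R=\begin{cases}(1-q)\,v_i\otimes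 v_j-\sqrt q\,(-1)^{|v_i||v_j|}v_j\otimes v_i & i<j,\\ \frac{(1-q)+(-1)^{|v_i|}(1+q)}{2}\,v_i\otimes v_j & i=j,\\ -\sqrt q\,(-1)^{|v_i||v_j|}v_j\otimes v_i & i>j.\end{cases}$$ For $1\le i\le r-1$ let $R_i$ be $R$ acting on the $i$-th and $(i+1)$-st tensor factors of $V^{\otimes r}$ and the identity on the others. Then $T_i\mapsto R_i$ defines a (right) representation $\Phi_{m,n}^{q,r}$ of $H_r(q)$ on $V^{\otimes r}$, called the sign $q$-permutation representation, and $\chi_{\Phi_{m,n}^{q,r}}(h)=\operatorname{trace}\Phi_{m,n}^{q,r}(h)$. *)

theory Defs
  imports
    "HOL-Algebra.QuotRing"
    "HOL-Library.Poly_Mapping"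
    "HOL-Library.FuncSet"
    "HOL-Computational_Algebra.Polynomial"
    "HOL-Computational_Algebra.Fraction_Field"
begin

text \<open>
  Words with concatenation, written additively because the convolution product of
  \<^theory>\<open>HOL-Library.Poly_Mapping\<close> is built on the additive structure of the index type.
  Hence \<^typ>\<open>'a list \<Rightarrow>\<^sub>0 'k\<close> is the free associative unital algebra over \<^typ>\<open>'k\<close> on
  the letters \<^typ>\<open>'a\<close>, or equivalently the tensor algebra of the vector space with
  basis \<^typ>\<open>'a\<close>; its product is the tensor product.
\<close>

instantiation list :: (type) monoid_add
begin

definition zero_list :: "'a list" where "zero_list = []"

definition plus_list :: "'a list \<Rightarrow> 'a list \<Rightarrow> 'a list" where "plus_list u w = u @ w"

instance by standard (simp_all add: zero_list_def plus_list_def)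

end

definition scalar :: "'k::field \<Rightarrow> 'a list \<Rightarrow>\<^sub>0 'k" where
  "scalar c = Poly_Mapping.single [] c"

definition of_word :: "'a list \<Rightarrow> 'a list \<Rightarrow>\<^sub>0 'k::field" where
  "of_word w = Poly_Mapping.single w 1"

definition linear_extension ::
  "('a list \<Rightarrow> ('b list \<Rightarrow>\<^sub>0 'k)) \<Rightarrow> ('a list \<Rightarrow>\<^sub>0 'k::field) \<Rightarrow> ('b list \<Rightarrow>\<^sub>0 'k)" where
  "linear_extension f x =
     (\<Sum>w\<in>Poly_Mapping.keys x. scalar (Poly_Mapping.lookup x w) * f w)"

definition free_algebra :: "'a set \<Rightarrow> ('a list \<Rightarrow>\<^sub>0 'k::field) ring" where
  "free_algebra A =
     \<lparr>carrier = {x. Poly_Mapping.keys x \<subseteq> lists A}, monoid.mult = (*), one = 1,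
      zero = 0, add = (+)\<rparr>"

definition hecke_relations :: "nat \<Rightarrow> 'k::field \<Rightarrow> (nat list \<Rightarrow>\<^sub>0 'k) set" where
  "hecke_relations r q =
     (let t = (\<lambda>i. of_word [i]) in
       {t i * t i - (scalar (1 - q) * t i + scalar q) | i. i \<in> {1..<r}} \<union>
       {t i * t j - t j * t i | i j. i \<in> {1..<r} \<and> j \<in> {1..<r} \<and> (i + 2 \<le> j \<or> j + 2 \<le> i)} \<union>
       {t i * t (i + 1) * t i - t (i + 1) * t i * t (i + 1) | i. i \<in> {1..<r} \<and> i + 1 \<in> {1..<r}})"

definition hecke_ideal :: "nat \<Rightarrow> 'k::field \<Rightarrow> (nat list \<Rightarrow>\<^sub>0 'k) set" where
  "hecke_ideal r q = genideal (free_algebra {1..<r}) (hecke_relations r q)"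

text \<open>
  For a field extension of the ground field, the algebra given by the same presentation
  over the larger field is the algebra obtained by extension of scalars.
\<close>

definition hecke_algebra :: "nat \<Rightarrow> 'k::field \<Rightarrow> (nat list \<Rightarrow>\<^sub>0 'k) set ring" where
  "hecke_algebra r q = free_algebra {1..<r} Quot hecke_ideal r q"

definition hecke_T :: "nat \<Rightarrow> 'k::field \<Rightarrow> nat \<Rightarrow> (nat list \<Rightarrow>\<^sub>0 'k) set" where
  "hecke_T r q i = hecke_ideal r q +>\<^bsub>free_algebra {1..<r}\<^esub> of_word [i]"

definition ordered_prod :: "('a, 'b) monoid_scheme \<Rightarrow> 'a list \<Rightarrow> 'a" where
  "ordered_prod G xs = foldr (monoid.mult G) xs \<one>\<^bsub>G\<^esub>"

text \<open>A partition is represented by the list of its nonzero parts, so its length is \<open>length \<mu>\<close>.\<close>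

definition is_partition :: "nat list \<Rightarrow> nat \<Rightarrow> bool" where
  "is_partition \<mu> r \<longleftrightarrow> sorted_wrt (\<ge>) \<mu> \<and> 0 \<notin> set \<mu> \<and> sum_list \<mu> = r"

definition partial_sum :: "nat list \<Rightarrow> nat \<Rightarrow> nat" where
  "partial_sum \<mu> i = sum_list (take i \<mu>)"

definition standard_element :: "nat \<Rightarrow> 'k::field \<Rightarrow> nat list \<Rightarrow> (nat list \<Rightarrow>\<^sub>0 'k) set" where
  "standard_element r q \<mu> =
     ordered_prod (hecke_algebra r q)
       (map (\<lambda>i. ordered_prod (hecke_algebra r q)
                   (map (hecke_T r q) [partial_sum \<mu> (i - 1) + 1 ..< partial_sum \<mu> i]))
         [1 ..< length \<mu> + 1])"

text \<open>
  The field obtained from the complex rational functions in \<open>q\<close> by adjoining a square root of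
  \<open>q\<close> is the field of rational functions in that square root.
\<close>

type_synonym rational_function = "complex poly fract"

definition sqrt_q :: rational_function where
  "sqrt_q = Fract [:0, 1:] 1"

definition q_ind :: rational_function where
  "q_ind = sqrt_q ^ 2"

text \<open>
  The basis vectors of \<open>V\<close> are the letters \<open>1, \<dots>, m + n\<close>; the basis of the \<open>r\<close>-th tensor
  power consists of the words of length \<open>r\<close>.
\<close>

definition parity :: "nat \<Rightarrow> nat \<Rightarrow> nat" where
  "parity m i = (if i \<le> m then 0 else 1)"

definition tensor_basis :: "nat \<Rightarrow> nat \<Rightarrow> nat \<Rightarrow> nat list set" where
  "tensor_basis m n r = {w. length w = r \<and> set w \<subseteq> {1..m + n}}"

definition tensor_power :: "nat \<Rightarrow> nat \<Rightarrow> nat \<Rightarrow> (nat list \<Rightarrow>\<^sub>0 rational_function) set" where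
  "tensor_power m n r = {v. Poly_Mapping.keys v \<subseteq> tensor_basis m n r}"

definition sign_R :: "nat \<Rightarrow> nat \<Rightarrow> nat \<Rightarrow> (nat list \<Rightarrow>\<^sub>0 rational_function)" where
  "sign_R m i j =
     (if i < j then
        scalar (1 - q_ind) * of_word [i, j]
        - scalar (sqrt_q * (-1) ^ (parity m i * parity m j)) * of_word [j, i]
      else if i = j then
        scalar (((1 - q_ind) + (-1) ^ parity m i * (1 + q_ind)) / 2) * of_word [i, j]
      else
        - (scalar (sqrt_q * (-1) ^ (parity m i * parity m j)) * of_word [j, i]))"

definition sign_R_at ::
  "nat \<Rightarrow> nat \<Rightarrow> (nat list \<Rightarrow>\<^sub>0 rational_function) \<Rightarrow> (nat list \<Rightarrow>\<^sub>0 rational_function)" where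
  "sign_R_at m i =
     linear_extension
       (\<lambda>w. of_word (take (i - 1) w) * sign_R m (w ! (i - 1)) (w ! i) * of_word (drop (i + 1) w))"

text \<open>
  The free algebra acts on the right, so the first letter of a word is applied first.
\<close>

definition free_action ::
  "nat \<Rightarrow> (nat list \<Rightarrow>\<^sub>0 rational_function) \<Rightarrow>
     (nat list \<Rightarrow>\<^sub>0 rational_function) \<Rightarrow> (nat list \<Rightarrow>\<^sub>0 rational_function)" where
  "free_action m x v = linear_extension (\<lambda>w. fold (sign_R_at m) w v) x"

text \<open>
  The action induced on the quotient: an element of the Hecke algebra is a coset, all of
  whose members act in the same way on the tensor power.
\<close>

definition sign_perm_rep ::
  "nat \<Rightarrow> nat \<Rightarrow> nat \<Rightarrow> (nat list \<Rightarrow>\<^sub>0 rational_function) set \<Rightarrow>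
     (nat list \<Rightarrow>\<^sub>0 rational_function) \<Rightarrow> (nat list \<Rightarrow>\<^sub>0 rational_function)" where
  "sign_perm_rep m n r h =
     (\<lambda>v\<in>tensor_power m n r. the_elem ((\<lambda>x. free_action m x v) ` h))"

definition tensor_trace ::
  "nat \<Rightarrow> nat \<Rightarrow> nat \<Rightarrow>
     ((nat list \<Rightarrow>\<^sub>0 rational_function) \<Rightarrow> (nat list \<Rightarrow>\<^sub>0 rational_function)) \<Rightarrow>
     rational_function" where
  "tensor_trace m n r F = (\<Sum>w\<in>tensor_basis m n r. Poly_Mapping.lookup (F (of_word w)) w)"

definition sign_perm_character ::
  "nat \<Rightarrow> nat \<Rightarrow> nat \<Rightarrow> (nat list \<Rightarrow>\<^sub>0 rational_function) set \<Rightarrow> rational_function" where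
  "sign_perm_character m n r h = tensor_trace m n r (sign_perm_rep m n r h)"

definition bicompositions :: "nat \<Rightarrow> (nat list \<times> nat list) set" where
  "bicompositions k =
     {(\<alpha>, \<beta>). 0 \<notin> set \<alpha> \<and> 0 \<notin> set \<beta> \<and> sum_list \<alpha> + sum_list \<beta> = k}"

end

theory Submission
  imports Defs
begin

text \<open>
  The trace is taken in the basis of words. On a pair of letters \<open>a b\<close> the operator \<open>R\<close> is the
  sum of a diagonal term and of a term that exchanges the letters and vanishes for \<open>a = b\<close>. The
  standard element is a product of generators with strictly increasing indices, so the generator
  with index \<open>i\<close> is the last one that touches the letter at position \<open>i\<close>. If it exchanges two
  different letters, position \<open>i\<close> keeps a wrong letter for ever, and the resulting word does not
  contribute to the trace. Hence the diagonal entry at a word is the product of the diagonal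
  coefficients of its neighbouring letters (\<open>lookup_fold_diagonal\<close>).

  No index of the standard element joins the last letter of one block to the first letter of the
  next one, so the trace is a product over the blocks (\<open>sum_diag_weight_standard_word\<close>). In one
  block a descent has weight \<open>0\<close>, an ascent has weight \<open>1 - q\<close>, and the repetition of a letter
  has weight \<open>1\<close> or \<open>-q\<close> according to its parity. What remains is a sum over weakly increasing
  words. Such a word is a choice of even letters and of odd letters together with their
  multiplicities, and the multiplicities form the two halves \<open>\<alpha>\<close>, \<open>\<beta>\<close> of a bicomposition: the
  choices of letters give the binomial coefficients, the repeated odd letters give the power of
  \<open>-q\<close>, and the ascents give the power of \<open>1 - q\<close>. The equality of the two sums
  (\<open>chain_sum_eq_bicomp_sum\<close>) is proved by adding one letter at a time to the alphabet, since both
  sides then change by the same recursion in the length of the word.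

  For all this the trace of a coset has to be computable from any representative. The elements of
  the free algebra that annihilate the tensor power form an ideal, and it contains the defining
  relations because \<open>R\<close> satisfies the quadratic relation and the braid relation; so the Hecke
  ideal acts as zero (\<open>hecke_ideal_annihilates\<close>), and a coset acts like each of its members
  (\<open>sign_perm_rep_coset\<close>).
\<close>

section \<open>Linear maps between free algebras\<close>

lemma scalar_mult_eq_map: "scalar c * x = Poly_Mapping.map ((*) c) x"
  by (simp add: scalar_def mult_map_scale_conv_mult zero_list_def)

lemma lookup_scalar_mult [simp]:
  "Poly_Mapping.lookup (scalar c * x) w = c * Poly_Mapping.lookup x w"
  by (simp add: scalar_mult_eq_map Poly_Mapping.map.rep_eq when_def)

lemma lookup_of_word: "Poly_Mapping.lookup (of_word u) w = (if w = u then 1 else 0)"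
  by (auto simp: of_word_def lookup_single when_def)

lemma linear_extension_of_word_id: "linear_extension of_word x = x"
proof (rule poly_mapping_eqI)
  fix w
  show "Poly_Mapping.lookup (linear_extension of_word x) w = Poly_Mapping.lookup x w"
    by (simp add: linear_extension_def lookup_sum lookup_of_word in_keys_iff
        sum.delta[OF finite_keys] if_distrib cong: if_cong)
qed

lemma scalar_commute: "x * scalar c = scalar c * (x :: 'a list \<Rightarrow>\<^sub>0 'k::field)"
proof -
  have "scalar d * of_word w * scalar c = scalar c * (scalar d * of_word w)"
    for d :: 'k and w :: "'a list"
    by (simp add: scalar_def of_word_def mult_single plus_list_def mult.commute)
  then have "linear_extension of_word x * scalar c = scalar c * linear_extension of_word x"
    by (simp add: linear_extension_def sum_distrib_left sum_distrib_right)
  then show ?thesis by (simp only: linear_extension_of_word_id)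
qed

lemma mult_scalar_left: "x * (scalar c * y) = scalar c * (x * (y :: 'a list \<Rightarrow>\<^sub>0 'k::field))"
  by (metis mult.assoc scalar_commute)

lemma scalar_mult_scalar: "scalar c * (scalar d * x) = scalar (c * d) * x"
  by (rule poly_mapping_eqI) (simp add: mult.assoc)

lemma scalar_0 [simp]: "scalar 0 = 0" and scalar_1 [simp]: "scalar 1 = 1"
  by (simp_all add: scalar_def flip: zero_list_def)

lemma of_word_mult [simp]: "of_word u * of_word w = of_word (u @ w)"
  by (simp add: of_word_def mult_single plus_list_def)

lemma of_word_Nil [simp]: "of_word [] = 1"
  by (simp add: of_word_def flip: zero_list_def)

lemma keys_of_word [simp]: "Poly_Mapping.keys (of_word w :: 'a list \<Rightarrow>\<^sub>0 'k::field) = {w}"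
  by (simp add: of_word_def)

definition linear_map ::
  "(('a list \<Rightarrow>\<^sub>0 'k::field) \<Rightarrow> ('b list \<Rightarrow>\<^sub>0 'k)) \<Rightarrow> bool" where
  "linear_map F \<longleftrightarrow> (\<forall>x y. F (x + y) = F x + F y) \<and> (\<forall>c x. F (scalar c * x) = scalar c * F x)"

lemma linear_map_add: "linear_map F \<Longrightarrow> F (x + y) = F x + F y"
  and linear_map_scalar: "linear_map F \<Longrightarrow> F (scalar c * x) = scalar c * F x"
  by (auto simp: linear_map_def)

lemma linear_map_zero: "linear_map F \<Longrightarrow> F 0 = 0"
  using linear_map_scalar[of F 0 0] by simp

lemma linear_map_minus:
  assumes "linear_map F" shows "F (- x) = - F x"
  using linear_map_add[OF assms, of x "- x"] linear_map_zero[OF assms]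
  by (simp add: eq_neg_iff_add_eq_0 add.commute)

lemma linear_map_diff: "linear_map F \<Longrightarrow> F (x - y) = F x - F y"
  using linear_map_add[of F x "- y"] by (simp add: linear_map_minus)

lemma linear_map_sum: "linear_map F \<Longrightarrow> F (sum f A) = (\<Sum>a\<in>A. F (f a))"
  by (induction A rule: infinite_finite_induct) (auto simp: linear_map_zero linear_map_add)

lemma linear_map_compose: "linear_map F \<Longrightarrow> linear_map G \<Longrightarrow> linear_map (\<lambda>x. F (G x))"
  by (simp add: linear_map_def)

lemma linear_map_mult_right: "linear_map (\<lambda>x. x * y)"
  by (simp add: linear_map_def distrib_right mult.assoc)

lemma linear_map_mult_left: "linear_map (\<lambda>x. y * x)"
  by (simp add: linear_map_def distrib_left mult_scalar_left)

lemma linear_extension_superset: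
  assumes "finite A" "Poly_Mapping.keys x \<subseteq> A"
  shows "linear_extension f x = (\<Sum>w\<in>A. scalar (Poly_Mapping.lookup x w) * f w)"
  unfolding linear_extension_def
  by (rule sum.mono_neutral_left) (use assms in \<open>auto simp: in_keys_iff\<close>)

lemma linear_map_linear_extension:
  fixes f :: "'a list \<Rightarrow> ('c list \<Rightarrow>\<^sub>0 'b::field)"
  shows "linear_map (linear_extension f)"
proof -
  have scalar_add: "scalar (c + d) = scalar c + (scalar d :: 'c list \<Rightarrow>\<^sub>0 'b)" for c d
    by (simp add: scalar_def single_add)
  have "linear_extension f (x + y) = linear_extension f x + linear_extension f y" for x y
  proof -
    let ?A = "Poly_Mapping.keys x \<union> Poly_Mapping.keys y"
    have "Poly_Mapping.keys (x + y) \<subseteq> ?A" by (rule keys_add)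
    then show ?thesis
      by (simp add: linear_extension_superset[of ?A] lookup_add scalar_add
          distrib_right sum.distrib)
  qed
  moreover have "linear_extension f (scalar c * x) = scalar c * linear_extension f x" for c x
  proof -
    have "Poly_Mapping.keys (scalar c * x) \<subseteq> Poly_Mapping.keys x"
      by (auto simp: in_keys_iff)
    then show ?thesis
      by (simp add: linear_extension_superset[of "Poly_Mapping.keys x"] sum_distrib_left
          scalar_mult_scalar)
  qed
  ultimately show ?thesis by (simp add: linear_map_def)
qed

lemma linear_extension_of_word [simp]: "linear_extension f (of_word w) = f w"
  by (simp add: linear_extension_def lookup_of_word)

lemma linear_map_expand:
  assumes "linear_map F"
  shows "F x = (\<Sum>w\<in>Poly_Mapping.keys x. scalar (Poly_Mapping.lookup x w) * F (of_word w))"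
proof -
  have "F x = F (linear_extension of_word x)" by (simp only: linear_extension_of_word_id)
  then show ?thesis
    by (simp add: linear_extension_def linear_map_sum[OF assms] linear_map_scalar[OF assms])
qed

lemma linear_map_eqI:
  assumes "linear_map F" "linear_map G"
    and "\<And>w. w \<in> Poly_Mapping.keys x \<Longrightarrow> F (of_word w) = G (of_word w)"
  shows "F x = G x"
proof -
  note linear_map_expand[OF assms(1), of x]
  also have "(\<Sum>w\<in>Poly_Mapping.keys x. scalar (Poly_Mapping.lookup x w) * F (of_word w)) =
      (\<Sum>w\<in>Poly_Mapping.keys x. scalar (Poly_Mapping.lookup x w) * G (of_word w))"
    by (intro sum.cong refl) (simp add: assms(3))
  also note linear_map_expand[OF assms(2), of x, symmetric]
  finally show ?thesis .
qed

lemma keys_linear_map_subset: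
  fixes F :: "('a list \<Rightarrow>\<^sub>0 'k::field) \<Rightarrow> ('b list \<Rightarrow>\<^sub>0 'k)"
  assumes "linear_map F"
    and "\<And>w. w \<in> Poly_Mapping.keys x \<Longrightarrow> Poly_Mapping.keys (F (of_word w)) \<subseteq> S"
  shows "Poly_Mapping.keys (F x) \<subseteq> S"
proof -
  have "Poly_Mapping.keys (scalar c * y) \<subseteq> Poly_Mapping.keys y" for c and y :: "'b list \<Rightarrow>\<^sub>0 'k"
    by (auto simp: in_keys_iff)
  then have "Poly_Mapping.keys
      (\<Sum>w\<in>Poly_Mapping.keys x. scalar (Poly_Mapping.lookup x w) * F (of_word w)) \<subseteq> S"
    using assms(2) by (fastforce dest!: subsetD[OF keys_sum])
  then show ?thesis by (simp only: linear_map_expand[OF assms(1), of x])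
qed

section \<open>The sign q-permutation operators\<close>

text \<open>
  The coefficients of \<open>v\<^sub>a \<otimes> v\<^sub>b\<close> and \<open>v\<^sub>b \<otimes> v\<^sub>a\<close> in \<open>(v\<^sub>a \<otimes> v\<^sub>b)R\<close>. For \<open>a = b\<close> the two tensors
  coincide and the whole coefficient is counted as diagonal; this convention gives one formula
  for \<open>R\<close> without case distinctions, which makes the relations below polynomial identities.
\<close>

definition diag_coeff :: "nat \<Rightarrow> nat \<Rightarrow> nat \<Rightarrow> rational_function" where
  "diag_coeff m a b =
     (if a < b then 1 - q_ind else if a = b then (if a \<le> m then 1 else - q_ind) else 0)"

definition swap_coeff :: "nat \<Rightarrow> nat \<Rightarrow> nat \<Rightarrow> rational_function" where
  "swap_coeff m a b = (if a = b then 0 else - (sqrt_q * (-1) ^ (parity m a * parity m b)))"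

lemma two_neq_zero: "(2 :: rational_function) \<noteq> 0"
proof -
  have "(2 :: rational_function) = Fract (of_nat 2) 1"
    unfolding Fract_of_nat_eq by simp
  also have "\<dots> \<noteq> 0" by (simp add: Zero_fract_def eq_fract)
  finally show ?thesis .
qed

text \<open>
  Both sides of the identity for one block are compared after multiplication by \<open>1 - q\<close>, which
  makes every distinct letter of a word contribute exactly one factor \<open>1 - q\<close>. This lemma removes
  the extra factor again.
\<close>

lemma one_minus_q_neq_zero: "1 - q_ind \<noteq> 0"
proof
  assume "1 - q_ind = 0"
  then have "q_ind = 1" by simp
  then have "Fract ([:0, 1:] * [:0, 1:]) 1 = (Fract 1 1 :: rational_function)"
    by (simp add: q_ind_def sqrt_q_def power2_eq_square One_fract_def)
  then show False by (simp add: eq_fract one_pCons)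
qed

lemma sign_R_eq:
  "sign_R m a b = scalar (diag_coeff m a b) * of_word [a, b] + scalar (swap_coeff m a b) * of_word [b, a]"
proof (rule poly_mapping_eqI)
  fix w
  \<comment> \<open>The diagonal coefficient at equal letters is the eigenvalue \<open>1\<close> or \<open>-q\<close>.\<close>
  have "((1 - q_ind) + (1 + q_ind)) / 2 = 1" "((1 - q_ind) - (1 + q_ind)) / 2 = - q_ind"
    using two_neq_zero by (simp_all add: field_simps)
  then show "Poly_Mapping.lookup (sign_R m a b) w =
      Poly_Mapping.lookup (scalar (diag_coeff m a b) * of_word [a, b] +
        scalar (swap_coeff m a b) * of_word [b, a]) w"
    by (auto simp: sign_R_def diag_coeff_def swap_coeff_def parity_def lookup_add lookup_minus)
qed

lemma linear_map_sign_R_at: "linear_map (sign_R_at m i)"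
  unfolding sign_R_at_def by (rule linear_map_linear_extension)

lemmas sign_R_at_linear =
  linear_map_add[OF linear_map_sign_R_at] linear_map_scalar[OF linear_map_sign_R_at]
  linear_map_zero[OF linear_map_sign_R_at]

lemma sign_R_at_of_word:
  assumes "i = Suc (length u)"
  shows "sign_R_at m i (of_word (u @ a # b # v)) =
    scalar (diag_coeff m a b) * of_word (u @ a # b # v) +
    scalar (swap_coeff m a b) * of_word (u @ b # a # v)"
  using assms
  by (simp add: sign_R_at_def nth_append sign_R_eq distrib_left distrib_right mult_scalar_left
      mult.assoc)


lemma split_word:
  assumes "i \<in> {1..<length w}"
  obtains u a b v where "w = u @ a # b # v" "i = Suc (length u)"
proof -
  have "drop (i - 1) w = w ! (i - 1) # drop i w"
    using Cons_nth_drop_Suc[of "i - 1" w] assms by auto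
  moreover have "drop i w = w ! i # drop (Suc i) w"
    using assms by (simp add: Cons_nth_drop_Suc)
  ultimately have "w = take (i - 1) w @ w ! (i - 1) # w ! i # drop (Suc i) w"
    by (metis append_take_drop_id)
  moreover have "i = Suc (length (take (i - 1) w))" using assms by auto
  ultimately show ?thesis using that by blast
qed

lemma swap_coeff_mult: "swap_coeff m a b * swap_coeff m b a = (if a = b then 0 else q_ind)"
  by (cases "a \<le> m"; cases "b \<le> m")
    (simp_all add: swap_coeff_def q_ind_def power2_eq_square parity_def)


lemma quadratic_relation:
  assumes "i \<in> {1..<length w}"
  shows "sign_R_at m i (sign_R_at m i (of_word w)) =
    scalar (1 - q_ind) * sign_R_at m i (of_word w) + scalar q_ind * of_word w"
proof -
  obtain u a b v where w: "w = u @ a # b # v" and i: "i = Suc (length u)"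
    using assms by (rule split_word)
  have 1: "diag_coeff m a b * diag_coeff m a b + swap_coeff m a b * swap_coeff m b a =
      (1 - q_ind) * diag_coeff m a b + q_ind"
    by (auto simp: swap_coeff_mult diag_coeff_def algebra_simps)
  have 2: "swap_coeff m a b * (diag_coeff m a b + diag_coeff m b a) = (1 - q_ind) * swap_coeff m a b"
    by (auto simp: swap_coeff_def diag_coeff_def)
  note at = sign_R_at_of_word[OF i]
  show ?thesis
  proof (rule poly_mapping_eqI)
    fix x
    let ?l = "\<lambda>y. Poly_Mapping.lookup (of_word y :: nat list \<Rightarrow>\<^sub>0 rational_function) x"
    have "Poly_Mapping.lookup (sign_R_at m i (sign_R_at m i (of_word w))) x =
      (diag_coeff m a b * diag_coeff m a b + swap_coeff m a b * swap_coeff m b a) * ?l w +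
      swap_coeff m a b * (diag_coeff m a b + diag_coeff m b a) * ?l (u @ b # a # v)"
      by (simp add: w at sign_R_at_linear lookup_add algebra_simps)
    then show "Poly_Mapping.lookup (sign_R_at m i (sign_R_at m i (of_word w))) x =
        Poly_Mapping.lookup
          (scalar (1 - q_ind) * sign_R_at m i (of_word w) + scalar q_ind * of_word w) x"
      unfolding 1 2 by (simp add: w at lookup_add algebra_simps)
  qed
qed


text \<open>
  The two operators change disjoint pairs of letters, and their coefficients depend only on the
  letters of their own pair.
\<close>

lemma commuting_relation:
  assumes "1 \<le> i" "i + 2 \<le> j" "j < length w"
  shows "sign_R_at m j (sign_R_at m i (of_word w)) = sign_R_at m i (sign_R_at m j (of_word w))"
proof -
  from assms have "i \<in> {1..<length w}" by simp
  then obtain u a b v where w: "w = u @ a # b # v" and i: "i = Suc (length u)"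
    by (rule split_word)
  have "j - i - 1 \<in> {1..<length v}" using assms by (simp add: w i) linarith
  then obtain u' c d v' where v: "v = u' @ c # d # v'" and j: "j - i - 1 = Suc (length u')"
    by (rule split_word)
  have at: "sign_R_at m j (of_word (u @ x # y # u' @ c' # d' # v')) =
      scalar (diag_coeff m c' d') * of_word (u @ x # y # u' @ c' # d' # v') +
      scalar (swap_coeff m c' d') * of_word (u @ x # y # u' @ d' # c' # v')" for x y c' d'
  proof -
    have "j = Suc (length (u @ x # y # u'))" using j i assms by simp
    from sign_R_at_of_word[OF this] show ?thesis by simp
  qed
  show ?thesis
    by (rule poly_mapping_eqI)
      (simp add: w v at sign_R_at_of_word[OF i] sign_R_at_linear lookup_add algebra_simps)
qed


text \<open>
  Both sides expand into the six arrangements of the three letters \<open>a b c\<close>. The coefficients of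
  \<open>b c a\<close>, \<open>c a b\<close> and \<open>c b a\<close> are the same monomials on both sides; for the other three
  arrangements the equality of the coefficients depends on the relative order of the letters.
\<close>

lemma braid_relation:
  assumes "1 \<le> i" "i + 1 < length w"
  shows "sign_R_at m i (sign_R_at m (i + 1) (sign_R_at m i (of_word w))) =
    sign_R_at m (i + 1) (sign_R_at m i (sign_R_at m (i + 1) (of_word w)))"
proof -
  let ?d = "diag_coeff m" and ?e = "swap_coeff m"
  from assms have "i \<in> {1..<length w}" by simp
  then obtain u a b v' where w': "w = u @ a # b # v'" and i: "i = Suc (length u)"
    by (rule split_word)
  from assms obtain c v where v': "v' = c # v" by (cases v') (auto simp: w' i)
  note w = w'[unfolded v']
  have at: "sign_R_at m (i + 1) (of_word (u @ x # y # z # v)) =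
      scalar (?d y z) * of_word (u @ x # y # z # v) +
      scalar (?e y z) * of_word (u @ x # z # y # v)" for x y z
    using sign_R_at_of_word[of "i + 1" "u @ [x]" m y z v] i by simp
  \<comment> \<open>Equal letters are harmless in the last two identities: their swap coefficient is zero.\<close>
  have abc: "?d a b * ?d b c * ?d a b + ?e a b * ?e b a * ?d a c =
      ?d b c * ?d a b * ?d b c + ?e b c * ?e c b * ?d a c"
    by (auto simp: swap_coeff_mult diag_coeff_def algebra_simps)
  have bac: "?d a b * ?d b c * ?e a b + ?e a b * ?d a c * ?d b a = ?d b c * ?e a b * ?d a c"
    by (auto simp: swap_coeff_def diag_coeff_def algebra_simps)
  have acb: "?d b c * ?d a b * ?e b c + ?e b c * ?d a c * ?d c b = ?d a b * ?e b c * ?d a c"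
    by (auto simp: swap_coeff_def diag_coeff_def algebra_simps)
  show ?thesis
  proof (rule poly_mapping_eqI)
    fix x
    let ?l = "\<lambda>y. Poly_Mapping.lookup (of_word (u @ y @ v) :: nat list \<Rightarrow>\<^sub>0 rational_function) x"
    have "Poly_Mapping.lookup
        (sign_R_at m i (sign_R_at m (i + 1) (sign_R_at m i (of_word w)))) x =
      (?d a b * ?d b c * ?d a b + ?e a b * ?e b a * ?d a c) * ?l [a, b, c] +
      (?d a b * ?d b c * ?e a b + ?e a b * ?d a c * ?d b a) * ?l [b, a, c] +
      ?d a b * ?e b c * ?d a c * ?l [a, c, b] + ?d a b * ?e b c * ?e a c * ?l [c, a, b] +
      ?e a b * ?e a c * ?d b c * ?l [b, c, a] + ?e a b * ?e a c * ?e b c * ?l [c, b, a]"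
      by (simp add: w at sign_R_at_of_word[OF i] sign_R_at_linear lookup_add
          del: One_nat_def add_Suc_right) (simp add: algebra_simps)
    moreover have "Poly_Mapping.lookup
        (sign_R_at m (i + 1) (sign_R_at m i (sign_R_at m (i + 1) (of_word w)))) x =
      (?d b c * ?d a b * ?d b c + ?e b c * ?e c b * ?d a c) * ?l [a, b, c] +
      (?d b c * ?d a b * ?e b c + ?e b c * ?d a c * ?d c b) * ?l [a, c, b] +
      ?d b c * ?e a b * ?d a c * ?l [b, a, c] + ?d a b * ?e b c * ?e a c * ?l [c, a, b] +
      ?e a b * ?e a c * ?d b c * ?l [b, c, a] + ?e a b * ?e a c * ?e b c * ?l [c, b, a]"
      by (simp add: w at sign_R_at_of_word[OF i] sign_R_at_linear lookup_add
          del: One_nat_def add_Suc_right) (simp add: algebra_simps)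
    ultimately show "Poly_Mapping.lookup
        (sign_R_at m i (sign_R_at m (i + 1) (sign_R_at m i (of_word w)))) x =
      Poly_Mapping.lookup
        (sign_R_at m (i + 1) (sign_R_at m i (sign_R_at m (i + 1) (of_word w)))) x"
      unfolding abc bac acb by simp
  qed
qed

section \<open>The action of the free algebra\<close>

lemma linear_map_fold: "linear_map (fold (sign_R_at m) w)"
  by (induction w) (auto simp: linear_map_def sign_R_at_linear)

lemma linear_map_free_action: "linear_map (free_action m x)"
proof -
  have "linear_map (\<lambda>v. scalar c * fold (sign_R_at m) w v)" for c w
    by (rule linear_map_compose[OF linear_map_mult_left linear_map_fold])
  then show ?thesis
    unfolding free_action_def[abs_def] linear_extension_def
    by (simp add: linear_map_def sum.distrib sum_distrib_left)
qed

lemma linear_map_free_action_left: "linear_map (\<lambda>x. free_action m x v)"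
  unfolding free_action_def by (rule linear_map_linear_extension)

lemma free_action_of_word [simp]: "free_action m (of_word w) v = fold (sign_R_at m) w v"
  by (simp add: free_action_def)

text \<open>
  Both sides are linear in \<open>x\<close> and in \<open>y\<close>, so it suffices to compare them on words, where
  concatenation of words becomes composition of operators. The factors appear in reversed order
  because the action is a right action.
\<close>

lemma free_action_mult: "free_action m (x * y) v = free_action m y (free_action m x v)"
proof (rule linear_map_eqI[of "\<lambda>x. free_action m (x * y) v" "\<lambda>x. free_action m y (free_action m x v)"])
  show "linear_map (\<lambda>x. free_action m (x * y) v)"
    by (rule linear_map_compose[OF linear_map_free_action_left linear_map_mult_right])
  show "linear_map (\<lambda>x. free_action m y (free_action m x v))"
    by (rule linear_map_compose[OF linear_map_free_action linear_map_free_action_left])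
  fix u
  show "free_action m (of_word u * y) v = free_action m y (free_action m (of_word u) v)"
  proof (rule linear_map_eqI[of "\<lambda>y. free_action m (of_word u * y) v"])
    show "linear_map (\<lambda>y. free_action m (of_word u * y) v)"
      by (rule linear_map_compose[OF linear_map_free_action_left linear_map_mult_left])
  qed (simp_all add: linear_map_free_action_left)
qed

text \<open>
  A set of words that is closed under exchanging the letters at positions \<open>i\<close> and \<open>i + 1\<close> spans an
  invariant subspace. This gives the invariance of the tensor power, and later, for words with a
  prescribed beginning, the reason why a misplaced letter is never repaired.
\<close>

lemma keys_sign_R_at:
  assumes "Poly_Mapping.keys v \<subseteq> S"
    and len: "\<And>w. w \<in> S \<Longrightarrow> i \<in> {1..<length w}"
    and swap: "\<And>u a b z. u @ a # b # z \<in> S \<Longrightarrow> i = Suc (length u) \<Longrightarrow> u @ b # a # z \<in> S"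
  shows "Poly_Mapping.keys (sign_R_at m i v) \<subseteq> S"
proof (rule keys_linear_map_subset[OF linear_map_sign_R_at])
  fix w assume "w \<in> Poly_Mapping.keys v"
  with assms(1) have w: "w \<in> S" by auto
  from split_word[OF len[OF this]] obtain u a b z
    where split: "w = u @ a # b # z" "i = Suc (length u)" by blast
  have "u @ b # a # z \<in> S" using swap w split by blast
  with w split(1) have "{u @ a # b # z, u @ b # a # z} \<subseteq> S" by simp
  then show "Poly_Mapping.keys (sign_R_at m i (of_word w)) \<subseteq> S"
    unfolding split(1) sign_R_at_of_word[OF split(2)]
    by (auto simp: in_keys_iff lookup_add lookup_of_word split: if_splits)
qed

lemma tensor_power_sign_R_at:
  assumes "i \<in> {1..<r}" "v \<in> tensor_power m n r"
  shows "sign_R_at m i v \<in> tensor_power m n r"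
proof -
  have "Poly_Mapping.keys (sign_R_at m i v) \<subseteq> tensor_basis m n r"
    by (rule keys_sign_R_at) (use assms in \<open>auto simp: tensor_power_def tensor_basis_def\<close>)
  then show ?thesis by (simp add: tensor_power_def)
qed

lemma tensor_power_fold:
  assumes "set w \<subseteq> {1..<r}" "v \<in> tensor_power m n r"
  shows "fold (sign_R_at m) w v \<in> tensor_power m n r"
  using assms by (induction w arbitrary: v) (auto simp: tensor_power_sign_R_at)

lemma tensor_power_free_action:
  assumes "x \<in> carrier (free_algebra {1..<r})" "v \<in> tensor_power m n r"
  shows "free_action m x v \<in> tensor_power m n r"
  unfolding tensor_power_def
proof (rule CollectI, rule keys_linear_map_subset[OF linear_map_free_action_left])
  fix w assume "w \<in> Poly_Mapping.keys x"
  with assms(1) have "set w \<subseteq> {1..<r}" by (auto simp: free_algebra_def)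
  then show "Poly_Mapping.keys (free_action m (of_word w) v) \<subseteq> tensor_basis m n r"
    using tensor_power_fold[OF _ assms(2), of w] by (simp add: tensor_power_def)
qed

section \<open>The Hecke algebra acts on tensor space\<close>

lemma free_algebra_simps [simp]:
  "x \<oplus>\<^bsub>free_algebra A\<^esub> y = x + y" "x \<otimes>\<^bsub>free_algebra A\<^esub> y = x * y"
  "\<zero>\<^bsub>free_algebra A\<^esub> = 0" "\<one>\<^bsub>free_algebra A\<^esub> = 1"
  by (simp_all add: free_algebra_def)

lemma free_algebra_carrier_add:
  "x \<in> carrier (free_algebra A) \<Longrightarrow> y \<in> carrier (free_algebra A) \<Longrightarrow>
    x + y \<in> carrier (free_algebra A)"
  using keys_add[of x y] by (auto simp: free_algebra_def)

lemma free_algebra_carrier_minus: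
  "x \<in> carrier (free_algebra A) \<Longrightarrow> - x \<in> carrier (free_algebra A)"
  by (simp add: free_algebra_def keys.rep_eq)

lemma free_algebra_carrier_diff:
  "x \<in> carrier (free_algebra A) \<Longrightarrow> y \<in> carrier (free_algebra A) \<Longrightarrow>
    x - y \<in> carrier (free_algebra A)"
  using free_algebra_carrier_add[OF _ free_algebra_carrier_minus, of x A y] by simp

lemma free_algebra_carrier_mult:
  "x \<in> carrier (free_algebra A) \<Longrightarrow> y \<in> carrier (free_algebra A) \<Longrightarrow>
    x * y \<in> carrier (free_algebra A)"
  using keys_mult[of x y] by (fastforce simp: free_algebra_def plus_list_def)

lemma free_algebra_carrier_of_word: "of_word w \<in> carrier (free_algebra A) \<longleftrightarrow> w \<in> lists A"
  by (simp add: free_algebra_def)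

lemma free_algebra_carrier_scalar: "scalar c \<in> carrier (free_algebra A)"
  by (auto simp: free_algebra_def scalar_def in_keys_iff lookup_single when_def split: if_splits)

lemma free_algebra_carrier_zero_one:
  "0 \<in> carrier (free_algebra A)" "1 \<in> carrier (free_algebra A)"
  using free_algebra_carrier_scalar[of 0 A] free_algebra_carrier_scalar[of 1 A] by simp_all

lemmas free_algebra_carrier =
  free_algebra_carrier_add free_algebra_carrier_minus free_algebra_carrier_diff free_algebra_carrier_mult
  free_algebra_carrier_of_word free_algebra_carrier_scalar free_algebra_carrier_zero_one

lemma ring_free_algebra: "ring (free_algebra A)"
proof (rule ringI)
  show "abelian_group (free_algebra A)"
  proof (rule abelian_groupI)
    fix x assume "x \<in> carrier (free_algebra A)"
    then show "\<exists>y\<in>carrier (free_algebra A). y \<oplus>\<^bsub>free_algebra A\<^esub> x = \<zero>\<^bsub>free_algebra A\<^esub>"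
      by (intro bexI[of _ "- x"]) (auto simp: free_algebra_carrier)
  qed (auto simp: free_algebra_carrier ac_simps)
  show "Group.monoid (free_algebra A)"
    by (rule monoidI) (auto simp: free_algebra_carrier mult.assoc)
qed (auto simp: algebra_simps)

lemma free_algebra_a_inv:
  assumes "x \<in> carrier (free_algebra A)"
  shows "\<ominus>\<^bsub>free_algebra A\<^esub> x = - x"
proof -
  interpret ring "free_algebra A" by (rule ring_free_algebra)
  show ?thesis
    by (rule minus_equality) (use assms in \<open>auto simp: free_algebra_carrier\<close>)
qed

definition tensor_annihilator :: "nat \<Rightarrow> nat \<Rightarrow> nat \<Rightarrow> (nat list \<Rightarrow>\<^sub>0 rational_function) set" where
  "tensor_annihilator m n r =
     {x \<in> carrier (free_algebra {1..<r}). \<forall>v\<in>tensor_power m n r. free_action m x v = 0}"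

text \<open>
  Closure under multiplication from the left uses that the tensor power is stable under the free
  algebra on the generators with index below \<open>r\<close>.
\<close>

lemma ideal_tensor_annihilator: "ideal (tensor_annihilator m n r) (free_algebra {1..<r})"
proof (rule idealI)
  interpret ring "free_algebra {1..<r} :: (nat list \<Rightarrow>\<^sub>0 rational_function) ring"
    by (rule ring_free_algebra)
  note lin = linear_map_free_action_left
  show "subgroup (tensor_annihilator m n r) (add_monoid (free_algebra {1..<r}))"
  proof (rule add.subgroupI)
    show "tensor_annihilator m n r \<noteq> {}"
      using linear_map_zero[OF lin, of m]
      by (auto simp: tensor_annihilator_def intro!: exI[of _ 0] free_algebra_carrier)
  qed (auto simp: tensor_annihilator_def linear_map_add[OF lin] linear_map_minus[OF lin]
      free_algebra_a_inv free_algebra_carrier)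
qed (auto simp: ring_free_algebra tensor_annihilator_def free_algebra_carrier free_action_mult
    tensor_power_free_action linear_map_zero[OF linear_map_free_action])

lemma hecke_relations_carrier: "hecke_relations r q \<subseteq> carrier (free_algebra {1..<r})"
proof -
  have "of_word [i] \<in> carrier (free_algebra {1..<r})" if "i \<in> {1..<r}" for i
    using that by (simp add: free_algebra_carrier_of_word)
  then show ?thesis
    unfolding hecke_relations_def Let_def
    by (safe intro!: free_algebra_carrier_add free_algebra_carrier_diff
        free_algebra_carrier_mult free_algebra_carrier_scalar)
qed

lemma tensor_annihilatorI:
  assumes "x \<in> carrier (free_algebra {1..<r})"
    and "\<And>w. w \<in> tensor_basis m n r \<Longrightarrow> free_action m x (of_word w) = 0"
  shows "x \<in> tensor_annihilator m n r"
proof -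
  have "free_action m x v = 0" if "v \<in> tensor_power m n r" for v
  proof (rule linear_map_eqI[OF linear_map_free_action])
    show "linear_map (\<lambda>v. 0)" by (simp add: linear_map_def)
  qed (use that in \<open>auto simp: tensor_power_def intro: assms(2)\<close>)
  with assms(1) show ?thesis by (simp add: tensor_annihilator_def)
qed

lemma hecke_relations_annihilate: "hecke_relations r q_ind \<subseteq> tensor_annihilator m n r"
proof
  fix x :: "nat list \<Rightarrow>\<^sub>0 rational_function"
  assume x: "x \<in> hecke_relations r q_ind"
  note lin = linear_map_free_action_left
  note act = linear_map_add[OF lin] linear_map_diff[OF lin] linear_map_scalar[OF lin]
  have act_scalar: "free_action m (scalar c) v = scalar c * v" for c v
    using linear_map_scalar[OF lin, of m c "of_word []" v] free_action_of_word[of m "[]" v]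
    by simp
  show "x \<in> tensor_annihilator m n r"
  proof (rule tensor_annihilatorI)
    show "x \<in> carrier (free_algebra {1..<r})" using x hecke_relations_carrier by blast
    fix w assume "w \<in> tensor_basis m n r"
    then have len: "length w = r" by (simp add: tensor_basis_def)
    from x consider
      (quad) i where "i \<in> {1..<r}"
        "x = of_word [i] * of_word [i] - (scalar (1 - q_ind) * of_word [i] + scalar q_ind)"
    | (comm) i j where "i \<in> {1..<r}" "j \<in> {1..<r}" "i + 2 \<le> j \<or> j + 2 \<le> i"
        "x = of_word [i] * of_word [j] - of_word [j] * of_word [i]"
    | (braid) i where "i \<in> {1..<r}" "i + 1 \<in> {1..<r}"
        "x = of_word [i] * of_word [i + 1] * of_word [i] -
             of_word [i + 1] * of_word [i] * of_word [i + 1]"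
      unfolding hecke_relations_def Let_def by blast
    then show "free_action m x (of_word w) = 0"
    proof cases
      case quad
      then show ?thesis
        by (simp add: act act_scalar quadratic_relation len)
    next
      case comm
      then show ?thesis
        using commuting_relation[of i j w m] commuting_relation[of j i w m]
        by (auto simp: act len)
    next
      case braid
      then show ?thesis
        using braid_relation[of i w m] by (simp add: act len)
    qed
  qed
qed

lemma ideal_hecke_ideal: "ideal (hecke_ideal r q) (free_algebra {1..<r})"
  unfolding hecke_ideal_def by (rule ring.genideal_ideal[OF ring_free_algebra hecke_relations_carrier])

lemma hecke_ideal_annihilates: "hecke_ideal r q_ind \<subseteq> tensor_annihilator m n r"
  unfolding hecke_ideal_def
  by (rule ring.genideal_minimal[OF ring_free_algebra ideal_tensor_annihilator
        hecke_relations_annihilate])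

text \<open>
  The set of values of all members of the coset at \<open>v\<close> is a singleton, because two members differ
  by an element of the Hecke ideal. It is nonempty since the ideal contains \<open>0\<close>.
\<close>

lemma sign_perm_rep_coset:
  assumes "v \<in> tensor_power m n r"
  shows "sign_perm_rep m n r (hecke_ideal r q_ind +>\<^bsub>free_algebra {1..<r}\<^esub> x) v = free_action m x v"
proof -
  have "free_action m y v = free_action m x v"
    if "y \<in> hecke_ideal r q_ind +>\<^bsub>free_algebra {1..<r}\<^esub> x" for y
  proof -
    from that obtain h where h: "h \<in> hecke_ideal r q_ind" "y = h + x"
      by (auto simp: a_r_coset_def r_coset_def)
    have "free_action m h v = 0"
      using h(1) hecke_ideal_annihilates[of r m n] assms by (auto simp: tensor_annihilator_def)
    then show ?thesis by (simp add: h(2) linear_map_add[OF linear_map_free_action_left])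
  qed
  moreover have "0 + x \<in> hecke_ideal r q_ind +>\<^bsub>free_algebra {1..<r}\<^esub> x"
    using additive_subgroup.zero_closed[OF ideal.axioms(1)[OF ideal_hecke_ideal], of r q_ind]
    by (force simp: a_r_coset_def r_coset_def)
  ultimately have "(\<lambda>y. free_action m y v) ` (hecke_ideal r q_ind +>\<^bsub>free_algebra {1..<r}\<^esub> x) =
      {free_action m x v}" unfolding add_0 by blast
  then show ?thesis using assms by (simp add: sign_perm_rep_def)
qed

lemma ordered_prod_cosets:
  assumes "\<And>w. w \<in> set ws \<Longrightarrow> w \<in> lists {1..<r}"
  shows "ordered_prod (hecke_algebra r q)
      (map (\<lambda>w. hecke_ideal r q +>\<^bsub>free_algebra {1..<r}\<^esub> of_word w) ws) =
    hecke_ideal r q +>\<^bsub>free_algebra {1..<r}\<^esub> of_word (concat ws)"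
  using assms
proof (induction ws)
  case Nil
  then show ?case by (simp add: ordered_prod_def hecke_algebra_def FactRing_def)
next
  case (Cons w ws)
  have "of_word w \<in> carrier (free_algebra {1..<r})"
    "of_word (concat ws) \<in> carrier (free_algebra {1..<r})"
    using Cons.prems by (fastforce simp: free_algebra_carrier_of_word)+
  from ideal.rcoset_mult_add[OF ideal_hecke_ideal this] Cons show ?case
    by (simp add: ordered_prod_def hecke_algebra_def FactRing_def)
qed

definition standard_word :: "nat list \<Rightarrow> nat list" where
  "standard_word \<mu> =
     concat (map (\<lambda>i. [partial_sum \<mu> (i - 1) + 1 ..< partial_sum \<mu> i]) [1 ..< length \<mu> + 1])"

lemma standard_element_eq_coset:
  assumes "set (standard_word \<mu>) \<subseteq> {1..<r}"
  shows "standard_element r q \<mu> = hecke_ideal r q +>\<^bsub>free_algebra {1..<r}\<^esub> of_word (standard_word \<mu>)"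
proof -
  let ?block = "\<lambda>i. [partial_sum \<mu> (i - 1) + 1 ..< partial_sum \<mu> i]"
  have block: "?block i \<in> lists {1..<r}" if "i \<in> set [1 ..< length \<mu> + 1]" for i
  proof -
    have "set (?block i) \<subseteq> set (standard_word \<mu>)"
      unfolding standard_word_def set_concat set_map using that by blast
    with assms show ?thesis unfolding in_lists_conv_set by blast
  qed
  have "ordered_prod (hecke_algebra r q) (map (hecke_T r q) (?block i)) =
      hecke_ideal r q +>\<^bsub>free_algebra {1..<r}\<^esub> of_word (?block i)"
    if "i \<in> set [1 ..< length \<mu> + 1]" for i
  proof -
    have "ordered_prod (hecke_algebra r q)
        (map (\<lambda>w. hecke_ideal r q +>\<^bsub>free_algebra {1..<r}\<^esub> of_word w) (map (\<lambda>j. [j]) (?block i))) =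
        hecke_ideal r q +>\<^bsub>free_algebra {1..<r}\<^esub> of_word (concat (map (\<lambda>j. [j]) (?block i)))"
    proof (rule ordered_prod_cosets)
      fix w assume "w \<in> set (map (\<lambda>j. [j]) (?block i))"
      with block[OF that] show "w \<in> lists {1..<r}" unfolding in_lists_conv_set by fastforce
    qed
    then show ?thesis
      by (simp only: map_map comp_def hecke_T_def[abs_def] concat_map_singleton list.map_ident)
  qed
  then have "standard_element r q \<mu> = ordered_prod (hecke_algebra r q)
      (map (\<lambda>w. hecke_ideal r q +>\<^bsub>free_algebra {1..<r}\<^esub> of_word w) (map ?block [1 ..< length \<mu> + 1]))"
    unfolding standard_element_def map_map comp_def by (intro arg_cong[where f = "ordered_prod _"] map_cong refl)
  also have "\<dots> = hecke_ideal r q +>\<^bsub>free_algebra {1..<r}\<^esub> of_word (standard_word \<mu>)"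
    unfolding standard_word_def
    by (rule ordered_prod_cosets) (use block in auto)
  finally show ?thesis .
qed

section \<open>Weakly increasing words and bicompositions\<close>

text \<open>
  The weight of a weakly increasing word: a letter \<open>a\<close> of multiplicity \<open>j\<close> contributes
  \<open>c * D a ^ (j - 1)\<close>. The initial letter carries a factor \<open>c\<close> like every other new letter, so
  that the weight is multiplicative over the distinct letters.
\<close>

fun chain_weight :: "'k::field \<Rightarrow> (nat \<Rightarrow> 'k) \<Rightarrow> nat list \<Rightarrow> 'k" where
  "chain_weight c D (a # b # w) = (if a = b then D a else c) * chain_weight c D (b # w)"
| "chain_weight c D [a] = c"
| "chain_weight c D [] = 1"

definition sorted_words :: "nat \<Rightarrow> nat \<Rightarrow> nat \<Rightarrow> nat list set" where
  "sorted_words N a k = {w. length w = k \<and> sorted w \<and> set w \<subseteq> {a..N}}"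

lemma finite_sorted_words [simp]: "finite (sorted_words N a k)"
  by (rule finite_subset[OF _ finite_lists_length_eq[of "{a..N}" k]])
    (auto simp: sorted_words_def)

lemma sorted_words_0 [simp]: "sorted_words N a 0 = {[]}"
  by (auto simp: sorted_words_def)

lemma sorted_words_Suc:
  assumes "a \<le> N"
  shows "sorted_words N a (Suc k) = sorted_words N (Suc a) (Suc k) \<union> (#) a ` sorted_words N a k"
    (is "?L = ?A \<union> ?B")
proof (intro equalityI subsetI)
  fix w assume w: "w \<in> ?L"
  then obtain b v where v: "w = b # v" by (cases w) (auto simp: sorted_words_def)
  show "w \<in> ?A \<union> ?B"
  proof (cases "b = a")
    case True
    then show ?thesis using w by (auto simp: v sorted_words_def)
  next
    case False
    then show ?thesis using w by (force simp: v sorted_words_def)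
  qed
next
  fix w assume "w \<in> ?A \<union> ?B"
  then show "w \<in> ?L" using assms by (force simp: sorted_words_def)
qed

definition chain_sum :: "'k::field \<Rightarrow> (nat \<Rightarrow> 'k) \<Rightarrow> nat \<Rightarrow> nat \<Rightarrow> nat \<Rightarrow> 'k" where
  "chain_sum c D N a k = (\<Sum>w\<in>sorted_words N a k. chain_weight c D w)"

text \<open>
  The part of the sum that belongs to words beginning with the letter \<open>a\<close>. It is separated
  because its recursion in the length removes a single letter, whereas the full sum would need a
  sum over the multiplicity of \<open>a\<close>.
\<close>

definition led_chain_sum :: "'k::field \<Rightarrow> (nat \<Rightarrow> 'k) \<Rightarrow> nat \<Rightarrow> nat \<Rightarrow> nat \<Rightarrow> 'k" where
  "led_chain_sum c D N a k =
     (case k of 0 \<Rightarrow> 0 | Suc j \<Rightarrow> (\<Sum>w\<in>sorted_words N a j. chain_weight c D (a # w)))"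

lemma chain_sum_0 [simp]: "chain_sum c D N a 0 = 1"
  by (simp add: chain_sum_def)

lemma led_chain_sum_0 [simp]: "led_chain_sum c D N a 0 = 0"
  by (simp add: led_chain_sum_def)

lemma sum_sorted_words_Suc:
  assumes "a \<le> N"
  shows "(\<Sum>w\<in>sorted_words N a (Suc k). f w) =
    (\<Sum>w\<in>sorted_words N (Suc a) (Suc k). f w) + (\<Sum>w\<in>sorted_words N a k. f (a # w))"
proof -
  have "sorted_words N (Suc a) (Suc k) \<inter> (#) a ` sorted_words N a k = {}"
    by (auto simp: sorted_words_def)
  then show ?thesis
    by (simp add: sorted_words_Suc[OF assms] sum.union_disjoint sum.reindex)
qed

lemma chain_sum_Suc:
  assumes "a \<le> N"
  shows "chain_sum c D N a k = chain_sum c D N (Suc a) k + led_chain_sum c D N a k"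
  by (cases k) (simp_all add: chain_sum_def led_chain_sum_def sum_sorted_words_Suc[OF assms])

text \<open>
  After the initial letter \<open>a\<close>, either \<open>a\<close> is repeated, or a word in larger letters follows.
\<close>

lemma led_chain_sum_Suc:
  assumes "a \<le> N"
  shows "led_chain_sum c D N a (Suc k) =
    D a * led_chain_sum c D N a k + c * chain_sum c D N (Suc a) k"
proof (cases k)
  case 0
  then show ?thesis by (simp add: led_chain_sum_def)
next
  case (Suc j)
  have "chain_weight c D (a # w) = c * chain_weight c D w"
    if "w \<in> sorted_words N (Suc a) (Suc j)" for w
    using that by (cases w) (auto simp: sorted_words_def)
  then show ?thesis
    by (simp add: Suc led_chain_sum_def chain_sum_def sum_sorted_words_Suc[OF assms]
        sum_distrib_left)
qed

lemma chain_sum_beyond: "N < a \<Longrightarrow> chain_sum c D N a (Suc k) = 0"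
proof -
  assume "N < a"
  then have "sorted_words N a (Suc k) = {}" by (auto simp: sorted_words_def)
  then show ?thesis by (simp add: chain_sum_def)
qed

text \<open>
  Even and odd letters enter with independent repetition weights \<open>x\<close> and \<open>y\<close>. This makes the sum
  symmetric in its two halves, so that a recursion for the first half also serves for the second.
\<close>

definition bicomp_sum :: "'k::field \<Rightarrow> 'k \<Rightarrow> 'k \<Rightarrow> nat \<Rightarrow> nat \<Rightarrow> nat \<Rightarrow> 'k" where
  "bicomp_sum c x y m n k = (\<Sum>(\<alpha>, \<beta>)\<in>bicompositions k.
     of_nat (m choose length \<alpha>) * of_nat (n choose length \<beta>)
     * x ^ (sum_list \<alpha> - length \<alpha>) * y ^ (sum_list \<beta> - length \<beta>) * c ^ (length \<alpha> + length \<beta>))"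

text \<open>
  The share of the bicompositions in which one distinguished even letter is used, the first entry
  of \<open>\<alpha>\<close> being its multiplicity: the remaining \<open>length \<alpha> - 1\<close> even letters are chosen among the
  other \<open>m\<close> ones.
\<close>

definition led_bicomp_sum :: "'k::field \<Rightarrow> 'k \<Rightarrow> 'k \<Rightarrow> nat \<Rightarrow> nat \<Rightarrow> nat \<Rightarrow> 'k" where
  "led_bicomp_sum c x y m n k = (\<Sum>(\<alpha>, \<beta>)\<in>{(\<alpha>, \<beta>)\<in>bicompositions k. \<alpha> \<noteq> []}.
     of_nat (m choose (length \<alpha> - 1)) * of_nat (n choose length \<beta>)
     * x ^ (sum_list \<alpha> - length \<alpha>) * y ^ (sum_list \<beta> - length \<beta>) * c ^ (length \<alpha> + length \<beta>))"

lemma length_le_sum_list: "0 \<notin> set \<alpha> \<Longrightarrow> length \<alpha> \<le> sum_list (\<alpha> :: nat list)"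
  by (induction \<alpha>) auto

lemma finite_bicompositions [simp]: "finite (bicompositions k)"
proof (rule finite_subset)
  let ?L = "{xs. set xs \<subseteq> {0..k} \<and> length xs \<le> k}"
  show "bicompositions k \<subseteq> ?L \<times> ?L"
  proof (clarsimp simp: bicompositions_def)
    fix \<alpha> \<beta> :: "nat list"
    assume "0 \<notin> set \<alpha>" "0 \<notin> set \<beta>"
    moreover have "\<alpha>' \<in> set \<gamma> \<Longrightarrow> \<alpha>' \<le> sum_list \<gamma>" for \<alpha>' and \<gamma> :: "nat list"
      by (rule member_le_sum_list) simp_all
    ultimately show "set \<alpha> \<subseteq> {0..sum_list \<alpha> + sum_list \<beta>} \<and>
        length \<alpha> \<le> sum_list \<alpha> + sum_list \<beta> \<and>
        set \<beta> \<subseteq> {0..sum_list \<alpha> + sum_list \<beta>} \<and> length \<beta> \<le> sum_list \<alpha> + sum_list \<beta>"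
      using length_le_sum_list[of \<alpha>] length_le_sum_list[of \<beta>] by (fastforce intro: trans_le_add1 trans_le_add2)
  qed
  show "finite (?L \<times> ?L)"
    by (intro finite_cartesian_product finite_lists_length_le) simp_all
qed

lemma bicomp_sum_0: "bicomp_sum c x y m n 0 = 1"
proof -
  have "bicompositions 0 = {([], [])}"
    by (auto simp: bicompositions_def) (metis list.set_intros(1) neq_Nil_conv)+
  then show ?thesis by (simp add: bicomp_sum_def)
qed

lemma led_bicomp_sum_0: "led_bicomp_sum c x y m n 0 = 0"
proof -
  have "{(\<alpha>, \<beta>) \<in> bicompositions 0. \<alpha> \<noteq> []} = {}"
    by (auto simp: bicompositions_def) (metis list.set_intros(1) neq_Nil_conv)
  then show ?thesis unfolding led_bicomp_sum_def by (simp only: sum.empty)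
qed

lemma bicomp_sum_no_letters: "bicomp_sum c x y 0 0 (Suc k) = 0"
  unfolding bicomp_sum_def
proof (rule sum.neutral, safe)
  fix \<alpha> \<beta> assume "(\<alpha>, \<beta>) \<in> bicompositions (Suc k)"
  then have "\<alpha> \<noteq> [] \<or> \<beta> \<noteq> []" by (auto simp: bicompositions_def)
  then have "0 choose length \<alpha> = 0 \<or> 0 choose length \<beta> = 0" by auto
  then show "of_nat (0 choose length \<alpha>) * of_nat (0 choose length \<beta>) *
      x ^ (sum_list \<alpha> - length \<alpha>) * y ^ (sum_list \<beta> - length \<beta>) * c ^ (length \<alpha> + length \<beta>) = 0"
    by (auto simp del: binomial_eq_0_iff)
qed

text \<open>
  This is Pascal's rule: the letter that is added to the alphabet is either not used or used.
\<close>

lemma bicomp_sum_Suc: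
  "bicomp_sum c x y (Suc m) n k = bicomp_sum c x y m n k + led_bicomp_sum c x y m n k"
proof -
  let ?t = "\<lambda>(\<alpha>, \<beta>). of_nat (n choose length \<beta>)
     * x ^ (sum_list \<alpha> - length \<alpha>) * y ^ (sum_list \<beta> - length \<beta>) * c ^ (length \<alpha> + length \<beta>)"
  have "led_bicomp_sum c x y m n k = (\<Sum>(\<alpha>, \<beta>)\<in>bicompositions k.
      (if \<alpha> = [] then 0 else of_nat (m choose (length \<alpha> - 1))) * ?t (\<alpha>, \<beta>))"
    unfolding led_bicomp_sum_def
    by (rule sum.mono_neutral_cong_left) (auto simp: mult.assoc)
  moreover have "of_nat (Suc m choose length \<alpha>) =
      (of_nat (m choose length \<alpha>) + (if \<alpha> = [] then 0 else of_nat (m choose (length \<alpha> - 1))) :: 'a)"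
    for \<alpha> :: "nat list"
    by (cases \<alpha>) simp_all
  ultimately show ?thesis
    unfolding bicomp_sum_def
    by (simp add: sum.distrib[symmetric] case_prod_beta algebra_simps)
qed

text \<open>
  The first entry of \<open>\<alpha>\<close> is decreased by one, which removes a factor \<open>x\<close>; if it is \<open>1\<close>, it is
  deleted instead, which removes a factor \<open>c\<close> and leaves an unrestricted bicomposition.
\<close>

lemma led_bicomp_sum_Suc:
  "led_bicomp_sum c x y m n (Suc k) =
    x * led_bicomp_sum c x y m n k + c * bicomp_sum c x y m n k"
proof -
  let ?t = "\<lambda>(\<alpha>, \<beta>). of_nat (m choose (length \<alpha> - 1)) * of_nat (n choose length \<beta>)
     * x ^ (sum_list \<alpha> - length \<alpha>) * y ^ (sum_list \<beta> - length \<beta>) * c ^ (length \<alpha> + length \<beta>)"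
  let ?B = "\<lambda>k. {(\<alpha>, \<beta>) \<in> bicompositions k. \<alpha> \<noteq> []}"
  \<comment> \<open>A bicomposition of \<open>k + 1\<close> with nonempty first half arises from one of \<open>k\<close>
    by increasing the first entry or by putting a new entry \<open>1\<close> in front, according to whether
    its first entry exceeds \<open>1\<close>.\<close>
  let ?grow = "\<lambda>(\<alpha>, \<beta> :: nat list). (Suc (hd \<alpha>) # tl \<alpha>, \<beta>)"
  let ?new = "\<lambda>(\<alpha>, \<beta> :: nat list). (Suc 0 # \<alpha>, \<beta>)"
  have "?B (Suc k) \<subseteq> ?grow ` ?B k \<union> ?new ` bicompositions k"
  proof
    fix p assume "p \<in> ?B (Suc k)"
    then obtain a' \<alpha> \<beta> where p': "p = (a' # \<alpha>, \<beta>)" "a' \<noteq> 0" "0 \<notin> set \<alpha>" "0 \<notin> set \<beta>"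
        "a' + sum_list \<alpha> + sum_list \<beta> = Suc k"
      by (auto simp: bicompositions_def neq_Nil_conv)
    then obtain a where "a' = Suc a" using not0_implies_Suc by blast
    with p' have p: "p = (Suc a # \<alpha>, \<beta>)" "0 \<notin> set \<alpha>" "0 \<notin> set \<beta>"
        "a + sum_list \<alpha> + sum_list \<beta> = k"
      by auto
    show "p \<in> ?grow ` ?B k \<union> ?new ` bicompositions k"
    proof (cases a)
      case 0
      then have "p = ?new (\<alpha>, \<beta>)" "(\<alpha>, \<beta>) \<in> bicompositions k"
        using p by (auto simp: bicompositions_def)
      then show ?thesis by blast
    next
      case (Suc b)
      then have "p = ?grow (a # \<alpha>, \<beta>)" "(a # \<alpha>, \<beta>) \<in> ?B k"
        using p by (auto simp: bicompositions_def)
      then show ?thesis by blast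
    qed
  qed
  moreover have "?grow ` ?B k \<union> ?new ` bicompositions k \<subseteq> ?B (Suc k)"
    by (auto simp: bicompositions_def neq_Nil_conv)
  ultimately have split: "?B (Suc k) = ?grow ` ?B k \<union> ?new ` bicompositions k" by (rule equalityI)
  have disj: "?grow ` ?B k \<inter> ?new ` bicompositions k = {}"
    by (auto simp: bicompositions_def neq_Nil_conv)
  have fin: "finite (?B k)" by (rule finite_subset[OF _ finite_bicompositions[of k]]) auto
  have inj: "inj_on ?grow (?B k)" "inj_on ?new (bicompositions k)"
    by (auto simp: inj_on_def neq_Nil_conv)
  have grow: "?t (?grow p) = x * ?t p" if "p \<in> ?B k" for p
  proof -
    from that obtain a' \<alpha> \<beta> where p': "p = (a' # \<alpha>, \<beta>)" "a' \<noteq> 0" "0 \<notin> set \<alpha>"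
      by (auto simp: bicompositions_def neq_Nil_conv)
    then obtain a where "a' = Suc a" using not0_implies_Suc by blast
    with p' have p: "p = (Suc a # \<alpha>, \<beta>)" "0 \<notin> set \<alpha>" by auto
    have "Suc a + sum_list \<alpha> - length \<alpha> = Suc (a + sum_list \<alpha> - length \<alpha>)"
      using length_le_sum_list[OF p(2)] by simp
    then show ?thesis by (simp add: p(1))
  qed
  have new: "?t (?new p) = c * (case p of (\<alpha>, \<beta>) \<Rightarrow>
      of_nat (m choose length \<alpha>) * of_nat (n choose length \<beta>)
      * x ^ (sum_list \<alpha> - length \<alpha>) * y ^ (sum_list \<beta> - length \<beta>) * c ^ (length \<alpha> + length \<beta>))"
    for p by (cases p) simp
  have "(\<Sum>p\<in>?B (Suc k). ?t p) =
      (\<Sum>p\<in>?B k. ?t (?grow p)) + (\<Sum>p\<in>bicompositions k. ?t (?new p))"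
    unfolding split
    by (subst sum.union_disjoint[OF _ _ disj])
      (simp_all only: fin finite_imageI finite_bicompositions sum.reindex[OF inj(1)]
        sum.reindex[OF inj(2)] comp_def)
  also have "(\<Sum>p\<in>?B k. ?t (?grow p)) = x * (\<Sum>p\<in>?B k. ?t p)"
    unfolding sum_distrib_left by (intro sum.cong refl grow)
  finally show ?thesis
    unfolding led_bicomp_sum_def bicomp_sum_def new sum_distrib_left .
qed

lemma bicomp_sum_swap: "bicomp_sum c x y m n k = bicomp_sum c y x n m k"
  unfolding bicomp_sum_def
  by (rule sum.reindex_bij_witness[of _ prod.swap prod.swap])
    (auto simp: bicompositions_def algebra_simps)

text \<open>
  Adding a new smallest letter changes both sums by the same recursion.
\<close>

lemma chain_step:
  assumes "a \<le> N" "D a = x"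
    and IH: "\<And>k. chain_sum c D N (Suc a) k = bicomp_sum c x y m n k"
  shows "chain_sum c D N a k = bicomp_sum c x y (Suc m) n k"
proof -
  have "led_chain_sum c D N a k = led_bicomp_sum c x y m n k" for k
    by (induction k)
      (simp_all add: led_bicomp_sum_0 led_chain_sum_Suc[OF assms(1)] led_bicomp_sum_Suc
        assms(2) IH)
  then show ?thesis by (simp add: chain_sum_Suc[OF assms(1)] IH bicomp_sum_Suc)
qed

text \<open>
  The alphabet is built up from its largest letter downwards, so the odd letters come first. For
  these the roles of \<open>\<alpha>\<close> and \<open>\<beta>\<close> are exchanged, because the recursion acts on the first half of
  the bicomposition.
\<close>

lemma chain_sum_eq_bicomp_sum:
  fixes D :: "nat \<Rightarrow> 'k::field"
  assumes even: "\<And>a. a \<le> m \<Longrightarrow> D a = x" and odd: "\<And>a. m < a \<Longrightarrow> D a = y"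
  shows "chain_sum c D (m + n) 1 k = bicomp_sum c x y m n k"
proof -
  have no_letters: "chain_sum c D (m + n) (Suc (m + n)) k = bicomp_sum c y x 0 0 k" for k
    by (cases k) (simp_all add: bicomp_sum_0 bicomp_sum_no_letters chain_sum_beyond)
  have odd_letters: "chain_sum c D (m + n) (Suc (m + n) - j) k = bicomp_sum c y x j 0 k"
    if "j \<le> n" for j k
    using that
  proof (induction j arbitrary: k)
    case 0
    show ?case by (simp add: no_letters)
  next
    case (Suc j)
    then show ?case
      by (intro chain_step) (auto intro!: odd simp: Suc_diff_le)
  qed
  have even_letters: "chain_sum c D (m + n) (Suc m - j) k = bicomp_sum c x y j n k"
    if "j \<le> m" for j k
    using that
  proof (induction j arbitrary: k)
    case 0
    show ?case using odd_letters[of n k] by (simp add: bicomp_sum_swap[of c x y])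
  next
    case (Suc j)
    then show ?case
      by (intro chain_step) (auto intro!: even simp: Suc_diff_le)
  qed
  show ?thesis using even_letters[of m k] by simp
qed

section \<open>The trace of the standard element\<close>

definition diag_weight :: "nat \<Rightarrow> nat list \<Rightarrow> nat list \<Rightarrow> rational_function" where
  "diag_weight m js w = (\<Prod>j\<leftarrow>js. diag_coeff m (w ! (j - 1)) (w ! j))"

text \<open>
  The operator with index \<open>j\<close> touches only the positions \<open>j\<close> and \<open>j + 1\<close>, which lie beyond the
  first \<open>i\<close> letters.
\<close>

lemma keys_fold_prefix:
  assumes "Poly_Mapping.keys v \<subseteq> {w. length w = r \<and> take i w = p}"
    and "\<And>j. j \<in> set js \<Longrightarrow> i < j \<and> j < r"
  shows "Poly_Mapping.keys (fold (sign_R_at m) js v) \<subseteq> {w. length w = r \<and> take i w = p}"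
  using assms
proof (induction js arbitrary: v)
  case (Cons j js)
  have "Poly_Mapping.keys (sign_R_at m j v) \<subseteq> {w. length w = r \<and> take i w = p}"
    using Cons.prems(2)[of j] by (intro keys_sign_R_at[OF Cons.prems(1)]) auto
  then show ?case using Cons.IH Cons.prems(2) by simp
qed simp

text \<open>
  By induction on the list of generators: the first one splits the word into itself and the word
  with two letters exchanged. All later generators have larger indices, so they cannot restore an
  exchanged letter, and only the diagonal term returns to the original word.
\<close>

lemma lookup_fold_diagonal:
  assumes "sorted_wrt (<) js" "set js \<subseteq> {1..<length w}"
  shows "Poly_Mapping.lookup (fold (sign_R_at m) js (of_word w)) w = diag_weight m js w"
  using assms
proof (induction js)
  case Nil
  then show ?case by (simp add: diag_weight_def lookup_of_word flip: of_word_Nil)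
next
  case (Cons i js)
  then have "i \<in> {1..<length w}" by simp
  then obtain u a b z where w: "w = u @ a # b # z" and i: "i = Suc (length u)"
    by (rule split_word)
  let ?w' = "u @ b # a # z"
  have "Poly_Mapping.lookup (fold (sign_R_at m) js (of_word ?w')) w = 0" if "a \<noteq> b"
  proof -
    have "Poly_Mapping.keys (fold (sign_R_at m) js (of_word ?w')) \<subseteq>
        {x. length x = length w \<and> take i x = take i ?w'}"
      by (rule keys_fold_prefix) (use Cons.prems w in auto)
    moreover have "take i w \<noteq> take i ?w'" using that by (simp add: w i)
    ultimately show ?thesis by (auto simp: in_keys_iff)
  qed
  then have "swap_coeff m a b * Poly_Mapping.lookup (fold (sign_R_at m) js (of_word ?w')) w = 0"
    by (cases "a = b") (auto simp: swap_coeff_def)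
  moreover have "sign_R_at m i (of_word w) =
      scalar (diag_coeff m a b) * of_word w + scalar (swap_coeff m a b) * of_word ?w'"
    unfolding w by (rule sign_R_at_of_word[OF i])
  moreover have "w ! (i - 1) = a" "w ! i = b" by (simp_all add: w i nth_append)
  ultimately show ?case
    using Cons
    by (simp add: linear_map_add[OF linear_map_fold] linear_map_scalar[OF linear_map_fold]
        lookup_add diag_weight_def)
qed

text \<open>
  The index \<open>k\<close> is missing between the two parts, so no generator links the letters at the
  positions \<open>k\<close> and \<open>k + 1\<close>.
\<close>

lemma standard_word_Cons:
  "standard_word (k # \<mu>) = [1..<k] @ map ((+) k) (standard_word \<mu>)"
proof -
  have sum: "partial_sum (k # \<mu>) (Suc i) = k + partial_sum \<mu> i" for i
    by (simp add: partial_sum_def)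
  have shift: "map ((+) k) [a..<b] = [k + a..<k + b]" for a b
    by (induction b) auto
  have zero: "partial_sum (k # \<mu>) 0 = 0" by (simp add: partial_sum_def)
  have one: "partial_sum (k # \<mu>) (Suc 0) = k" by (simp add: partial_sum_def)
  have indices: "[1 ..< length (k # \<mu>) + 1] = 1 # map Suc [1 ..< length \<mu> + 1]"
    by (simp add: map_Suc_upt upt_conv_Cons del: upt_Suc)
  have block: "[partial_sum (k # \<mu>) i + 1 ..< partial_sum (k # \<mu>) (Suc i)] =
      map ((+) k) [partial_sum \<mu> (i - 1) + 1 ..< partial_sum \<mu> i]"
    if i: "i \<in> set [1 ..< length \<mu> + 1]" for i
  proof -
    have "1 \<le> i" using i by (simp only: set_upt atLeastLessThan_iff)
    then obtain j where "i = Suc j" by (cases i) auto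
    then show ?thesis by (simp add: sum shift del: upt_Suc)
  qed
  have blocks: "map (\<lambda>i. [partial_sum (k # \<mu>) i + 1 ..< partial_sum (k # \<mu>) (Suc i)])
        [1 ..< length \<mu> + 1] =
      map (\<lambda>i. map ((+) k) [partial_sum \<mu> (i - 1) + 1 ..< partial_sum \<mu> i])
        [1 ..< length \<mu> + 1]"
    by (intro map_cong refl block)
  show ?thesis
    unfolding standard_word_def map_concat indices
    using arg_cong[OF blocks, of concat] by (simp add: zero one comp_def del: upt_Suc)
qed

lemma standard_word_increasing:
  "sorted_wrt (<) (standard_word \<mu>) \<and> set (standard_word \<mu>) \<subseteq> {1..<sum_list \<mu>}"
proof (induction \<mu>)
  case Nil
  show ?case by (simp add: standard_word_def)
next
  case (Cons k \<mu>)
  then show ?case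
    by (force simp: standard_word_Cons sorted_wrt_append sorted_wrt_map)
qed

lemma tensor_basis_eq: "tensor_basis m n r = {w. set w \<subseteq> {1..m + n} \<and> length w = r}"
  by (auto simp: tensor_basis_def)

lemma finite_tensor_basis [simp]: "finite (tensor_basis m n r)"
  unfolding tensor_basis_eq by (rule finite_lists_length_eq) simp

lemma character_standard_element:
  assumes "sum_list \<mu> = r"
  shows "sign_perm_character m n r (standard_element r q_ind \<mu>) =
    (\<Sum>w\<in>tensor_basis m n r. diag_weight m (standard_word \<mu>) w)"
  unfolding sign_perm_character_def tensor_trace_def
proof (rule sum.cong[OF refl])
  fix w assume w: "w \<in> tensor_basis m n r"
  have word: "sorted_wrt (<) (standard_word \<mu>)" "set (standard_word \<mu>) \<subseteq> {1..<r}"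
    using standard_word_increasing[of \<mu>] assms by auto
  have "of_word w \<in> tensor_power m n r" using w by (simp add: tensor_power_def)
  then have "sign_perm_rep m n r (standard_element r q_ind \<mu>) (of_word w) =
      fold (sign_R_at m) (standard_word \<mu>) (of_word w)"
    by (simp add: standard_element_eq_coset[OF word(2)] sign_perm_rep_coset del: One_nat_def)
  then show "Poly_Mapping.lookup
      (sign_perm_rep m n r (standard_element r q_ind \<mu>) (of_word w)) w =
      diag_weight m (standard_word \<mu>) w"
    using word w by (simp add: lookup_fold_diagonal tensor_basis_def del: One_nat_def)
qed

lemma diag_weight_append:
  assumes "set js \<subseteq> {1..<sum_list \<mu>}" "length u = k" "length v = sum_list \<mu>"
  shows "diag_weight m ([1..<k] @ map ((+) k) js) (u @ v) =
    diag_weight m [1..<k] u * diag_weight m js v"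
proof -
  have "map (\<lambda>j. diag_coeff m ((u @ v) ! (j - 1)) ((u @ v) ! j)) [1..<k] =
      map (\<lambda>j. diag_coeff m (u ! (j - 1)) (u ! j)) [1..<k]"
    by (rule map_cong) (use assms(2) in \<open>auto simp: nth_append\<close>)
  moreover have "map (\<lambda>j. diag_coeff m ((u @ v) ! (j - 1)) ((u @ v) ! j)) (map ((+) k) js) =
      map (\<lambda>j. diag_coeff m (v ! (j - 1)) (v ! j)) js"
    unfolding map_map
    by (rule map_cong[OF refl]) (use assms in \<open>auto simp: nth_append subset_iff\<close>)
  ultimately show ?thesis unfolding diag_weight_def by (simp only: map_append prod_list.append)
qed

lemma sum_tensor_basis_add:
  "(\<Sum>w\<in>tensor_basis m n (k + l). f w) =
    (\<Sum>u\<in>tensor_basis m n k. \<Sum>v\<in>tensor_basis m n l. f (u @ v))"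
proof -
  have "(\<Sum>(u, v)\<in>tensor_basis m n k \<times> tensor_basis m n l. f (u @ v)) =
      (\<Sum>w\<in>tensor_basis m n (k + l). f w)"
    by (rule sum.reindex_bij_witness[of _ "\<lambda>w. (take k w, drop k w)" "\<lambda>(u, v). u @ v"])
      (auto simp: tensor_basis_def dest: in_set_takeD in_set_dropD)
  then show ?thesis by (simp add: sum.cartesian_product)
qed

text \<open>
  The weight of a word is the product of the weights of its blocks, and the blocks of a word range
  over all words of the given lengths independently.
\<close>

lemma sum_diag_weight_standard_word:
  "(\<Sum>w\<in>tensor_basis m n (sum_list \<mu>). diag_weight m (standard_word \<mu>) w) =
    (\<Prod>k\<leftarrow>\<mu>. \<Sum>w\<in>tensor_basis m n k. diag_weight m [1..<k] w)"
proof (induction \<mu>)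
  case Nil
  have "tensor_basis m n 0 = {[]}" by (auto simp: tensor_basis_def)
  then show ?case by (simp add: standard_word_def diag_weight_def)
next
  case (Cons k \<mu>)
  have "(\<Sum>w\<in>tensor_basis m n (sum_list (k # \<mu>)). diag_weight m (standard_word (k # \<mu>)) w) =
      (\<Sum>u\<in>tensor_basis m n k. \<Sum>v\<in>tensor_basis m n (sum_list \<mu>).
        diag_weight m [1..<k] u * diag_weight m (standard_word \<mu>) v)"
    unfolding standard_word_Cons sum_list.Cons sum_tensor_basis_add
    by (intro sum.cong refl diag_weight_append[OF conjunct2[OF standard_word_increasing]])
      (auto simp: tensor_basis_def)
  then show ?case by (simp only: sum_product[symmetric] Cons.IH list.map prod_list.Cons)
qed

text \<open>
  The eigenvalue of \<open>R\<close> on \<open>v\<^sub>a \<otimes> v\<^sub>a\<close>.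
\<close>

definition letter_weight :: "nat \<Rightarrow> nat \<Rightarrow> rational_function" where
  "letter_weight m a = (if a \<le> m then 1 else - q_ind)"

text \<open>
  A descent has diagonal coefficient \<open>0\<close>, so only weakly increasing words survive. The factor
  \<open>1 - q\<close> on the left is the one that the chain weight assigns to the initial letter.
\<close>

lemma diag_weight_block:
  assumes "w \<noteq> []"
  shows "(1 - q_ind) * diag_weight m [1..<length w] w =
    (if sorted w then chain_weight (1 - q_ind) (letter_weight m) w else 0)"
  using assms
proof (induction w rule: induct_list012)
  case (3 a b w)
  have upt: "[1..<length (a # b # w)] = 1 # map Suc [1..<length (b # w)]"
    by (simp add: map_Suc_upt upt_conv_Cons del: upt_Suc)
  have tail: "map (\<lambda>j. diag_coeff m ((a # b # w) ! (j - 1)) ((a # b # w) ! j))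
      (map Suc [1..<length (b # w)]) =
      map (\<lambda>j. diag_coeff m ((b # w) ! (j - 1)) ((b # w) ! j)) [1..<length (b # w)]"
    unfolding map_map
    by (rule map_cong[OF refl]) (auto simp: nth_Cons split: nat.splits)
  have "diag_weight m [1..<length (a # b # w)] (a # b # w) =
      diag_coeff m a b * diag_weight m [1..<length (b # w)] (b # w)"
    unfolding diag_weight_def upt list.map tail prod_list.Cons by simp
  then have "(1 - q_ind) * diag_weight m [1..<length (a # b # w)] (a # b # w) =
      diag_coeff m a b * (if sorted (b # w) then chain_weight (1 - q_ind) (letter_weight m) (b # w) else 0)"
    using "3.IH"(2) by (simp del: upt_Suc)
  moreover have "diag_coeff m a b =
      (if a < b then 1 - q_ind else if a = b then letter_weight m a else 0)"
    by (simp add: diag_coeff_def letter_weight_def)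
  ultimately show ?case by (auto simp del: upt_Suc)
qed (simp_all add: diag_weight_def)

lemma sum_diag_weight_block:
  assumes "k > 0"
  shows "(1 - q_ind) * (\<Sum>w\<in>tensor_basis m n k. diag_weight m [1..<k] w) =
    bicomp_sum (1 - q_ind) 1 (- q_ind) m n k"
proof -
  have "(1 - q_ind) * (\<Sum>w\<in>tensor_basis m n k. diag_weight m [1..<k] w) =
      (\<Sum>w\<in>tensor_basis m n k. if sorted w then chain_weight (1 - q_ind) (letter_weight m) w else 0)"
    unfolding sum_distrib_left
  proof (rule sum.cong[OF refl])
    fix w assume "w \<in> tensor_basis m n k"
    then have "length w = k" "w \<noteq> []" using assms by (auto simp: tensor_basis_def)
    then show "(1 - q_ind) * diag_weight m [1..<k] w =
        (if sorted w then chain_weight (1 - q_ind) (letter_weight m) w else 0)"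
      using diag_weight_block[of w m] by simp
  qed
  also have "\<dots> = chain_sum (1 - q_ind) (letter_weight m) (m + n) 1 k"
    unfolding chain_sum_def
    by (rule sum.mono_neutral_cong_right, rule finite_tensor_basis)
      (auto simp: tensor_basis_def sorted_words_def)
  also have "\<dots> = bicomp_sum (1 - q_ind) 1 (- q_ind) m n k"
    by (rule chain_sum_eq_bicomp_sum) (simp_all add: letter_weight_def)
  finally show ?thesis .
qed

lemma bicomp_sum_factor:
  assumes "k > 0"
  shows "bicomp_sum c 1 y m n k = c * (\<Sum>(\<alpha>, \<beta>)\<in>bicompositions k.
    of_nat (m choose length \<alpha>) * of_nat (n choose length \<beta>)
    * y ^ (sum_list \<beta> - length \<beta>) * c ^ (length \<alpha> + length \<beta> - 1))"
  unfolding bicomp_sum_def sum_distrib_left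
proof (rule sum.cong[OF refl], clarify)
  fix \<alpha> \<beta> assume "(\<alpha>, \<beta>) \<in> bicompositions k"
  then have "\<alpha> \<noteq> [] \<or> \<beta> \<noteq> []" using assms by (auto simp: bicompositions_def)
  then obtain l where "length \<alpha> + length \<beta> = Suc l"
    using not0_implies_Suc[of "length \<alpha> + length \<beta>"] by auto
  then show "of_nat (m choose length \<alpha>) * of_nat (n choose length \<beta>)
      * 1 ^ (sum_list \<alpha> - length \<alpha>) * y ^ (sum_list \<beta> - length \<beta>) * c ^ (length \<alpha> + length \<beta>) =
    c * (of_nat (m choose length \<alpha>) * of_nat (n choose length \<beta>)
      * y ^ (sum_list \<beta> - length \<beta>) * c ^ (length \<alpha> + length \<beta> - 1))"
    by simp
qed

theorem theoremA:
  fixes r m n :: nat and \<mu> :: "nat list"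
  assumes "r \<ge> 1" and "m + n > 0" and "is_partition \<mu> r"
  shows "sign_perm_character m n r (standard_element r q_ind \<mu>) =
    (\<Prod>i\<in>{1..length \<mu>}. \<Sum>(\<alpha>, \<beta>)\<in>bicompositions (\<mu> ! (i - 1)).
       of_nat (m choose length \<alpha>) * of_nat (n choose length \<beta>)
       * (- q_ind) ^ (sum_list \<beta> - length \<beta>)
       * (1 - q_ind) ^ (length \<alpha> + length \<beta> - 1))"
proof -
  let ?S = "\<lambda>k. \<Sum>(\<alpha>, \<beta>)\<in>bicompositions k.
       of_nat (m choose length \<alpha>) * of_nat (n choose length \<beta>)
       * (- q_ind) ^ (sum_list \<beta> - length \<beta>)
       * (1 - q_ind) ^ (length \<alpha> + length \<beta> - 1)"
  from assms(3) have \<mu>: "0 \<notin> set \<mu>" "sum_list \<mu> = r" by (auto simp: is_partition_def)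
  have "sign_perm_character m n r (standard_element r q_ind \<mu>) =
      (\<Prod>k\<leftarrow>\<mu>. \<Sum>w\<in>tensor_basis m n k. diag_weight m [1..<k] w)"
    using character_standard_element[OF \<mu>(2)] sum_diag_weight_standard_word[where m = m and n = n and \<mu> = \<mu>] \<mu>(2)
    by simp
  also have "\<dots> = (\<Prod>k\<leftarrow>\<mu>. ?S k)"
  proof (intro arg_cong[where f = prod_list] map_cong refl)
    fix k assume "k \<in> set \<mu>"
    with \<mu>(1) have "k > 0" by (metis neq0_conv)
    then have "(1 - q_ind) * (\<Sum>w\<in>tensor_basis m n k. diag_weight m [1..<k] w) = (1 - q_ind) * ?S k"
      by (simp only: sum_diag_weight_block bicomp_sum_factor)
    then show "(\<Sum>w\<in>tensor_basis m n k. diag_weight m [1..<k] w) = ?S k"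
      by (simp only: mult_left_cancel[OF one_minus_q_neq_zero])
  qed
  also have "\<dots> = (\<Prod>i<length \<mu>. ?S (\<mu> ! i))"
    by (simp add: prod.list_conv_set_nth atLeast0LessThan)
  also have "\<dots> = (\<Prod>i\<in>{1..length \<mu>}. ?S (\<mu> ! (i - 1)))"
    by (rule prod.reindex_bij_witness[of _ "\<lambda>i. i - 1" Suc]) auto
  finally show ?thesis .
qed

end
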